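(* For every positive integer $n$, the bar visibility number of the transitive tournament $T_n$ satisfies $b(T_n)\le\lceil n/4\rceil$.
   Context: Digraphs are finite, without loops or multiple arcs. A bar is a horizontal line segment of positive length in the plane; bars do not overlap (bars at the same height may at most share an endpoint). A channel is a vertical strip of positive width. One bar sees another bar above it if there is an unblocked channel between them, i.e. a vertical strip of positive width meeting both bars such that no other bar meets the part of the strip between the two. A $t$-bar visibility representation of a digraph $G$ assigns each vertex at most $t$ bars in the plane so that, for distinct vertices $x,y$, there is an arc $xy$ (from $x$ to $y$) in $G$ if and only if some bar for $x$ sees some bar for $y$ above it along an unblocked channel (visibilities between two bars of the same vertex are ignored). The bar visibility number $b(G)$ is the least $t$ such that $G$ has a $t$-bar visibility representation. The transitive tournament $T_n$ is the digraph on $v_1,\ldots,v_n$ with arc set $\{v_iv_j : i<j\}$. *)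

theory Defs
  imports
    Complex_Main
    "HOL-Library.Extended_Nat"
    "Graph_Theory.Pair_Digraph"
begin

record bar =
  left :: real
  right :: real
  height :: real

definition proper_bar :: "bar \<Rightarrow> bool" where
  "proper_bar b \<longleftrightarrow> left b < right b"

definition bar_points :: "bar \<Rightarrow> (real \<times> real) set" where
  "bar_points b = {left b..right b} \<times> {height b}"

text \<open>Two bars at the same height may share an endpoint, but no more. A proper bar overlaps itself.\<close>

definition nonoverlapping :: "bar \<Rightarrow> bar \<Rightarrow> bool" where
  "nonoverlapping s t \<longleftrightarrow>
     (height s = height t \<longrightarrow> right s \<le> left t \<or> right t \<le> left s)"

text \<open>The channel is the strip over \<open>{c..d}\<close>; it meets a bar in its full width, that is,
  \<open>{c..d}\<close> lies in the horizontal extent of both bars. Bars of any vertex can block.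
  For finitely many bars, closed and open strips give the same relation (shrink the strip).\<close>

definition sees :: "bar set \<Rightarrow> bar \<Rightarrow> bar \<Rightarrow> bool" where
  "sees S s t \<longleftrightarrow> height s < height t \<and>
     (\<exists>c d. c < d \<and> {c..d} \<subseteq> {left s..right s} \<and> {c..d} \<subseteq> {left t..right t} \<and>
        (\<forall>u \<in> S - {s, t}. bar_points u \<inter> ({c..d} \<times> {height s<..<height t}) = {}))"

text \<open>Non-overlap is required for all distinct pairs (vertex, bar), so in particular
  no bar is assigned to two vertices.\<close>

definition bar_visibility_representation ::
    "nat \<Rightarrow> 'a pair_pre_digraph \<Rightarrow> ('a \<Rightarrow> bar set) \<Rightarrow> bool" where
  "bar_visibility_representation t G B \<longleftrightarrow>
     (\<forall>x \<in> pverts G. finite (B x) \<and> card (B x) \<le> t \<and> (\<forall>b \<in> B x. proper_bar b)) \<and>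
     (\<forall>x \<in> pverts G. \<forall>y \<in> pverts G. \<forall>b \<in> B x. \<forall>c \<in> B y.
        (x, b) \<noteq> (y, c) \<longrightarrow> nonoverlapping b c) \<and>
     (\<forall>x \<in> pverts G. \<forall>y \<in> pverts G. x \<noteq> y \<longrightarrow>
        ((x, y) \<in> parcs G \<longleftrightarrow>
           (\<exists>b \<in> B x. \<exists>c \<in> B y. sees (\<Union>z \<in> pverts G. B z) b c)))"

text \<open>The least \<open>t\<close> is taken in \<^typ>\<open>enat\<close>, so that it is \<open>\<infinity>\<close> if there is no representation;
  a finite upper bound therefore asserts that one exists.\<close>

definition bar_visibility_number :: "'a pair_pre_digraph \<Rightarrow> enat" where
  "bar_visibility_number G =
     Inf (enat ` {t. \<exists>B. bar_visibility_representation t G B})"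

definition transitive_tournament :: "nat \<Rightarrow> nat pair_pre_digraph" where
  "transitive_tournament n =
     \<lparr> pverts = {1..n}, parcs = {(i, j). i \<in> {1..n} \<and> j \<in> {1..n} \<and> i < j} \<rparr>"

lemma pair_digraph_transitive_tournament: "pair_digraph (transitive_tournament n)"
proof
  show "finite (parcs (transitive_tournament n))"
    by (rule finite_subset[of _ "{1..n} \<times> {1..n}"]) (auto simp: transitive_tournament_def)
qed (auto simp: transitive_tournament_def)

end

theory Submission
  imports Defs
begin

text \<open>
  Let \<open>n \<le> 4k\<close> and put every bar of vertex \<open>x\<close> at height \<open>x\<close>. Then no wrong visibility can arise,
  and deleting the vertices beyond \<open>n\<close> destroys none, so it suffices that each pair of vertices
  \<open>x < y \<le> 4k\<close> sees each other somewhere when each vertex has at most \<open>k\<close> bars.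

  Use \<open>k\<close> side-by-side blocks. In block \<open>i\<close> the vertices \<open>i\<close> and \<open>4k + 1 - i\<close> get a bar across the
  whole block, and each vertex strictly between them gets one bar in a staircase in which only
  consecutive bars overlap. Every vertex of the staircase thus sees both long bars, and the long
  bars see each other at the end of the block; this covers all pairs that meet
  \<open>{1..k} \<union> {3k+1..4k}\<close>. Consecutive bars of the staircase also see each other. So the pairs inside
  the remaining \<open>2k\<close> vertices are covered if these appear in block \<open>i\<close> in the order of the \<open>i\<close>-th
  path in the zigzag decomposition of \<open>K\<^sub>2\<^sub>k\<close> into \<open>k\<close> Hamiltonian paths.
\<close>

section \<open>Zigzag Hamiltonian paths\<close>

text \<open>The zigzag path \<open>i, i + 1, i - 1, i + 2, i - 2, \<dots>\<close> modulo \<open>2k\<close>: \<open>zigzag k e\<close> is the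
  position of the vertex \<open>i + e\<close>, for \<open>0 < e < 3k\<close>.\<close>

definition zigzag :: "nat \<Rightarrow> nat \<Rightarrow> nat" where
  "zigzag k e = (if e \<le> k then 2 * e - 1 else if e \<le> 2 * k then 4 * k - 2 * e else 2 * e - 4 * k - 1)"

lemma zigzag_cases:
  assumes "0 < e"
  obtains "e \<le> k" "zigzag k e + 1 = 2 * e" | "k < e" "e \<le> 2 * k" "zigzag k e + 2 * e = 4 * k"
    | "2 * k < e" "zigzag k e + 4 * k + 1 = 2 * e"
proof -
  consider "e \<le> k" | "k < e" "e \<le> 2 * k" | "2 * k < e" by linarith
  then show thesis
    by cases (use assms that in \<open>auto simp: zigzag_def\<close>)
qed

lemma even_zigzag:
  assumes "0 < e"
  shows "even (zigzag k e) \<longleftrightarrow> k < e \<and> e \<le> 2 * k"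
  by (rule zigzag_cases[OF assms, of k]; simp; presburger)

lemma zigzag_less:
  assumes "0 < e" "e < 3 * k"
  shows "zigzag k e < 2 * k"
  using assms by (auto simp: zigzag_def)

text \<open>Parity of the position separates the middle branch of \<open>zigzag\<close> from the
  outer two; these agree with each other only at arguments \<open>2k\<close> apart, which the bounds
  exclude.\<close>

lemma zigzag_inj:
  assumes "0 < e" "0 < f" "e < f + 2 * k" "f < e + 2 * k" "zigzag k e = zigzag k f"
  shows "e = f"
proof -
  have parity: "k < e \<and> e \<le> 2 * k \<longleftrightarrow> k < f \<and> f \<le> 2 * k"
    using assms even_zigzag by metis
  show ?thesis
    by (rule zigzag_cases[OF assms(1), of k]; rule zigzag_cases[OF assms(2), of k])
      (use assms(3-5) parity in linarith)+
qed

text \<open>Neighbours on the path have offsets summing to 0 or 1 modulo \<open>2k\<close>. In each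
  case the bounds put \<open>e\<close> and \<open>f\<close> on adjacent branches.\<close>

lemma zigzag_neighbours:
  assumes e: "0 < e" "e < f" "f < e + 2 * k"
    and sum: "e + f = 2 * k \<or> e + f = 2 * k + 1 \<or> e + f = 4 * k \<or> e + f = 4 * k + 1"
  shows "zigzag k f = Suc (zigzag k e) \<or> zigzag k e = Suc (zigzag k f)"
proof -
  have "0 < f" using e by simp
  note cases = zigzag_cases[OF \<open>0 < e\<close>, of k] zigzag_cases[OF \<open>0 < f\<close>, of k]
  have "zigzag k f = Suc (zigzag k e)" if "e + f = 2 * k"
    by (rule cases(1); rule cases(2)) (use e that in linarith)+
  moreover have "zigzag k e = Suc (zigzag k f)" if "e + f = 2 * k + 1"
    by (rule cases(1); rule cases(2)) (use e that in linarith)+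
  moreover have "zigzag k e = Suc (zigzag k f)" if "e + f = 4 * k"
    by (rule cases(1); rule cases(2)) (use e that in linarith)+
  moreover have "zigzag k f = Suc (zigzag k e)" if "e + f = 4 * k + 1"
    by (rule cases(1); rule cases(2)) (use e that in linarith)+
  ultimately show ?thesis
    using sum by blast
qed

section \<open>Layout of the blocks\<close>

text \<open>The path fills the positions below \<open>2k\<close>; the shift by \<open>2k\<close>
  gives the outer vertices distinct positions after it.\<close>

definition pos :: "nat \<Rightarrow> nat \<Rightarrow> nat \<Rightarrow> nat" where
  "pos k i x = (if k < x \<and> x \<le> 3 * k then zigzag k (x - i) else 2 * k + x)"

definition long_in :: "nat \<Rightarrow> nat \<Rightarrow> nat \<Rightarrow> bool" where
  "long_in k i x \<longleftrightarrow> x = i \<or> x + i = 4 * k + 1"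

text \<open>The staircase bar at position \<open>p\<close> spans \<open>[4p, 4p + 5]\<close>: it
  shares \<open>[4p + 4, 4p + 5]\<close> with the next one, and no other staircase bar meets
  \<open>[4p + 2, 4p + 3]\<close>. For \<open>x\<close> up to \<open>4k\<close>, \<open>p\<close> is
  at most \<open>6k\<close>, so long bars extend beyond the staircase.\<close>

definition lend :: "nat \<Rightarrow> nat \<Rightarrow> nat \<Rightarrow> nat" where
  "lend k i x = (if long_in k i x then 0 else 4 * pos k i x)"

definition rend :: "nat \<Rightarrow> nat \<Rightarrow> nat \<Rightarrow> nat" where
  "rend k i x = (if long_in k i x then 24 * k + 7 else 4 * pos k i x + 5)"

definition offset :: "nat \<Rightarrow> nat \<Rightarrow> nat" where
  "offset k i = (24 * k + 8) * i"

definition block_bar :: "nat \<Rightarrow> nat \<Rightarrow> nat \<Rightarrow> bar" where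
  "block_bar k i x =
     \<lparr>left = real (offset k i + lend k i x), right = real (offset k i + rend k i x), height = real x\<rparr>"

definition blocks :: "nat \<Rightarrow> nat \<Rightarrow> nat set" where
  "blocks k x = {i \<in> {1..k}. i \<le> x \<and> x + i \<le> 4 * k + 1}"

definition vertex_bars :: "nat \<Rightarrow> nat \<Rightarrow> bar set" where
  "vertex_bars k x = (\<lambda>i. block_bar k i x) ` blocks k x"

lemma block_bar_sel [simp]:
  "left (block_bar k i x) = real (offset k i + lend k i x)"
  "right (block_bar k i x) = real (offset k i + rend k i x)"
  "height (block_bar k i x) = real x"
  by (simp_all add: block_bar_def)

lemma pos_inj:
  assumes "1 \<le> i" "i \<le> k" "pos k i x = pos k i y"
  shows "x = y"
proof (cases "(k < x \<and> x \<le> 3 * k) \<and> (k < y \<and> y \<le> 3 * k)")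
  case True
  then have "zigzag k (x - i) = zigzag k (y - i)"
    using assms(3) by (simp add: pos_def)
  then have "x - i = y - i"
    by (rule zigzag_inj[rotated 4]) (use True assms(1,2) in linarith)+
  then show ?thesis
    using True assms by linarith
next
  case False
  have inner: "pos k i z < 2 * k" if "k < z" "z \<le> 3 * k" for z
  proof -
    have "zigzag k (z - i) < 2 * k"
      by (rule zigzag_less) (use that assms(1,2) in linarith)+
    with that show ?thesis by (simp add: pos_def)
  qed
  have outer: "pos k i z = 2 * k + z" if "\<not> (k < z \<and> z \<le> 3 * k)" for z
    unfolding pos_def if_not_P[OF that] ..
  show ?thesis
  proof (cases "k < x \<and> x \<le> 3 * k")
    case True
    with False inner[of x] outer[of y] assms(3) show ?thesis by linarith
  next
    case x: False
    show ?thesis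
    proof (cases "k < y \<and> y \<le> 3 * k")
      case True
      with x inner[of y] outer[of x] assms(3) show ?thesis by linarith
    next
      case False
      with x outer assms(3) show ?thesis by simp
    qed
  qed
qed

text \<open>The sum of two neighbours on the path of block \<open>i\<close> is \<open>2i\<close> or \<open>2i + 1\<close> modulo \<open>2k\<close>.\<close>

lemma pos_consecutive:
  assumes "k < x" "x < y" "y \<le> 3 * k"
  obtains i where "1 \<le> i" "i \<le> k"
    "pos k i y = Suc (pos k i x) \<or> pos k i x = Suc (pos k i y)"
proof -
  \<comment> \<open>The representative of \<open>x + y\<close> modulo \<open>2k\<close> in
    \<open>{2..2k + 1}\<close>, so that halving it gives a block number in
    \<open>{1..k}\<close>.\<close>
  define s where "s = (if x + y \<le> 4 * k + 1 then x + y - 2 * k else x + y - 4 * k)"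
  define i where "i = s div 2"
  have i: "1 \<le> i" "i \<le> k" and s: "s = 2 * i \<or> s = 2 * i + 1"
    using assms unfolding i_def s_def by (auto split: if_splits)
  have "x + y = s + 2 * k \<or> x + y = s + 4 * k"
    using assms unfolding s_def by auto
  moreover have "x - i + (y - i) + 2 * i = x + y"
    using assms i by linarith
  ultimately have "x - i + (y - i) = 2 * k \<or> x - i + (y - i) = 2 * k + 1 \<or>
      x - i + (y - i) = 4 * k \<or> x - i + (y - i) = 4 * k + 1"
    using s by (elim disjE) auto
  then have "zigzag k (y - i) = Suc (zigzag k (x - i)) \<or> zigzag k (x - i) = Suc (zigzag k (y - i))"
    by (intro zigzag_neighbours) (use assms i in linarith)+
  then have "pos k i y = Suc (pos k i x) \<or> pos k i x = Suc (pos k i y)"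
    using assms by (simp add: pos_def)
  with i that show thesis by blast
qed

lemma rend_le:
  assumes "1 \<le> i" "i \<le> k" "x \<le> 4 * k"
  shows "rend k i x \<le> 24 * k + 7"
    and "\<not> long_in k i x \<Longrightarrow> rend k i x \<le> 24 * k + 5"
proof -
  have "zigzag k (x - i) < 2 * k" if "k < x" "x \<le> 3 * k"
    using that assms by (intro zigzag_less) auto
  then have "pos k i x \<le> 6 * k"
    using assms unfolding pos_def by auto
  then show "rend k i x \<le> 24 * k + 7" "\<not> long_in k i x \<Longrightarrow> rend k i x \<le> 24 * k + 5"
    by (auto simp: rend_def)
qed

lemma offset_less: "i < j \<Longrightarrow> offset k i + (24 * k + 8) \<le> offset k j"
  unfolding offset_def by (metis Suc_leI add.commute mult_Suc_right mult_le_mono2)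

lemma different_blocks:
  assumes "i \<in> blocks k x" "j \<in> blocks k y" "i \<noteq> j" "x \<le> 4 * k" "y \<le> 4 * k"
  shows "offset k i + (24 * k + 7) < offset k j + lend k j y \<or> offset k j + rend k j y < offset k i"
proof -
  have "rend k j y \<le> 24 * k + 7"
    using assms by (intro rend_le) (auto simp: blocks_def)
  then show ?thesis
    using assms(3) offset_less[of i j k] offset_less[of j i k] by (auto simp: nat_neq_iff)
qed

section \<open>Visibility inside a block\<close>

text \<open>Only vertices strictly between \<open>x\<close> and \<open>y\<close> have bars at
  blocking heights, and bars of other blocks miss the strip because of the gap between
  blocks.\<close>

lemma sees_in_block:
  assumes xy: "x < y" "y \<le> 4 * k" and i: "i \<in> blocks k x" "i \<in> blocks k y"
    and cd: "c < d" "lend k i x \<le> c" "d \<le> rend k i x" "lend k i y \<le> c" "d \<le> rend k i y"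
    and free: "\<And>z. x < z \<Longrightarrow> z < y \<Longrightarrow> rend k i z < c \<or> d < lend k i z"
    and S: "S \<subseteq> (\<Union>z\<in>{1..4 * k}. vertex_bars k z)"
  shows "sees S (block_bar k i x) (block_bar k i y)"
proof -
  have "bar_points u \<inter> ({real (offset k i + c)..real (offset k i + d)} \<times> {real x<..<real y}) = {}"
    if "u \<in> S" for u
  proof -
    from that S obtain z j where z: "z \<le> 4 * k" and j: "j \<in> blocks k z" and u: "u = block_bar k j z"
      by (fastforce simp: vertex_bars_def)
    have "offset k j + rend k j z < offset k i + c \<or> offset k i + d < offset k j + lend k j z"
      if "x < z" "z < y"
    proof (cases "i = j")
      case True
      with free[OF that] show ?thesis by auto
    next
      case False
      have "d \<le> 24 * k + 7"
        using rend_le(1)[of i k x] cd xy i by (simp add: blocks_def)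
      with different_blocks[OF i(1) j False] xy z show ?thesis by auto
    qed
    then show ?thesis
      unfolding u bar_points_def by (auto simp flip: of_nat_add)
  qed
  moreover have "real (offset k i + c) < real (offset k i + d)"
    using cd by simp
  ultimately show ?thesis
    unfolding sees_def using xy cd
    by (intro conjI exI[of _ "real (offset k i + c)"] exI[of _ "real (offset k i + d)"]) auto
qed

lemma staircase_ends:
  assumes "1 \<le> i" "i \<le> k" "i < z" "z + i \<le> 4 * k"
  shows "lend k i z = 4 * pos k i z" "rend k i z = 4 * pos k i z + 5" "\<not> long_in k i z"
  using assms by (auto simp: lend_def rend_def long_in_def)

lemma long_bar_ends [simp]:
  assumes "long_in k i x"
  shows "lend k i x = 0" "rend k i x = 24 * k + 7"
  using assms by (auto simp: lend_def rend_def)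

lemma vertices_see:
  assumes xy: "1 \<le> x" "x < y" "y \<le> 4 * k"
    and S: "S \<subseteq> (\<Union>z\<in>{1..4 * k}. vertex_bars k z)"
  obtains i where "i \<in> blocks k x" "i \<in> blocks k y" "sees S (block_bar k i x) (block_bar k i y)"
proof (cases "k < x \<and> y \<le> 3 * k")
  case True
  with xy obtain i where i: "1 \<le> i" "i \<le> k"
    and consec: "pos k i y = Suc (pos k i x) \<or> pos k i x = Suc (pos k i y)"
    using pos_consecutive by metis
  \<comment> \<open>The bars at positions \<open>p - 1\<close> and \<open>p\<close> overlap in
    \<open>[4p, 4p + 1]\<close>.\<close>
  define p where "p = max (pos k i x) (pos k i y)"
  have ib: "i \<in> blocks k x" "i \<in> blocks k y"
    using i True xy by (auto simp: blocks_def)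
  have stair: "lend k i z = 4 * pos k i z" "rend k i z = 4 * pos k i z + 5" if "x \<le> z" "z \<le> y" for z
    using staircase_ends[of i k z] i True that by auto
  have "sees S (block_bar k i x) (block_bar k i y)"
  proof (rule sees_in_block[OF xy(2,3) ib _ _ _ _ _ _ S, where c = "4 * p" and d = "4 * p + 1"])
    fix z assume z: "x < z" "z < y"
    then have "pos k i z \<noteq> pos k i x" "pos k i z \<noteq> pos k i y"
      using pos_inj[OF i] by (metis less_irrefl)+
    then show "rend k i z < 4 * p \<or> 4 * p + 1 < lend k i z"
      using consec stair[of z] z unfolding p_def by auto
  qed (use consec stair[of x] stair[of y] xy in \<open>auto simp: p_def\<close>)
  with ib that show thesis by blast
next
  case False
  \<comment> \<open>The last block containing both vertices: at least one of them has its long bar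
    there.\<close>
  define i where "i = min (min x (4 * k + 1 - x)) (min y (4 * k + 1 - y))"
  have i: "1 \<le> i" "i \<le> k" and le: "i \<le> x" "y + i \<le> 4 * k + 1"
    and long: "x = i \<or> y + i = 4 * k + 1"
    using False xy unfolding i_def by auto
  have ib: "i \<in> blocks k x" "i \<in> blocks k y"
    using i le xy by (auto simp: blocks_def)
  have stair: "lend k i z = 4 * pos k i z" "rend k i z = 4 * pos k i z + 5" "\<not> long_in k i z"
    if "i < z" "z + i < 4 * k + 1" for z
    using staircase_ends[of i k z] i that by auto
  have inside: "4 * pos k i z + 5 \<le> 24 * k + 5" if "i < z" "z + i < 4 * k + 1" for z
    using rend_le(2)[of i k z] stair[OF that] i that by simp
  \<comment> \<open>This strip serves when just one of the two bars is long.\<close>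
  have single: "rend k i z < 4 * pos k i u + 2 \<or> 4 * pos k i u + 3 < lend k i z"
    if "x < z" "z < y" "z \<noteq> u" for z u
    using pos_inj[OF i, of z u] stair[of z] that le by fastforce
  consider "x = i" "y + i = 4 * k + 1" | "x = i" "y + i < 4 * k + 1" | "i < x" "y + i = 4 * k + 1"
    using long le by fastforce
  then have "sees S (block_bar k i x) (block_bar k i y)"
  proof cases
    case 1
    then have "long_in k i x" "long_in k i y" by (auto simp: long_in_def)
    \<comment> \<open>The strip lies past the staircase, which ends by
      \<open>24k + 5\<close>.\<close>
    then show ?thesis
      using 1 stair inside
      by (intro sees_in_block[OF xy(2,3) ib _ _ _ _ _ _ S, where c = "24 * k + 6" and d = "24 * k + 7"])
        (auto simp: less_Suc_eq_le)
  next
    case 2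
    then have "long_in k i x" by (auto simp: long_in_def)
    then show ?thesis
      using 2 stair[of y] inside[of y] single[of _ y] xy
      by (intro sees_in_block[OF xy(2,3) ib _ _ _ _ _ _ S,
            where c = "4 * pos k i y + 2" and d = "4 * pos k i y + 3"]) auto
  next
    case 3
    then have "long_in k i y" by (auto simp: long_in_def)
    then show ?thesis
      using 3 stair[of x] inside[of x] single[of _ x] xy
      by (intro sees_in_block[OF xy(2,3) ib _ _ _ _ _ _ S,
            where c = "4 * pos k i x + 2" and d = "4 * pos k i x + 3"]) auto
  qed
  with ib that show thesis by blast
qed

section \<open>The representation and the bound\<close>

lemma transitive_tournament_representation:
  assumes n: "n \<le> 4 * k"
  shows "bar_visibility_representation k (transitive_tournament n) (vertex_bars k)"
proof -
  define S where "S = (\<Union>z\<in>{1..n}. vertex_bars k z)"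
  have S: "S \<subseteq> (\<Union>z\<in>{1..4 * k}. vertex_bars k z)"
    unfolding S_def using n by (intro UN_mono) auto
  have card: "finite (vertex_bars k x) \<and> card (vertex_bars k x) \<le> k" for x
  proof -
    have "blocks k x \<subseteq> {1..k}"
      by (auto simp: blocks_def)
    then have "finite (blocks k x)" "card (blocks k x) \<le> k"
      using finite_subset card_mono[of "{1..k}" "blocks k x"] by auto
    then show ?thesis
      unfolding vertex_bars_def using card_image_le[of "blocks k x"] by (auto intro: order_trans)
  qed
  have proper: "proper_bar b" if "b \<in> vertex_bars k x" for b x
    using that by (auto simp: vertex_bars_def proper_bar_def lend_def rend_def)
  have nonoverlap: "nonoverlapping b c"
    if x: "x \<in> {1..n}" and y: "y \<in> {1..n}" and b: "b \<in> vertex_bars k x" and c: "c \<in> vertex_bars k y"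
      and ne: "(x, b) \<noteq> (y, c)" for x y b c
  proof -
    obtain i j where i: "i \<in> blocks k x" "b = block_bar k i x" and j: "j \<in> blocks k y" "c = block_bar k j y"
      using b c by (auto simp: vertex_bars_def)
    show ?thesis
    \<comment> \<open>Different vertices have different heights, so only bars of one vertex in
      different blocks need an argument.\<close>
    proof (cases "x = y")
      case True
      then have "i \<noteq> j" using i j ne by auto
      moreover have "rend k i x \<le> 24 * k + 7"
        using i x n by (intro rend_le) (auto simp: blocks_def)
      ultimately show ?thesis
        using different_blocks[OF i(1) j(1)] x y n True
        unfolding nonoverlapping_def i j block_bar_sel of_nat_le_iff by auto
    qed (simp add: nonoverlapping_def i j)
  qed
  have "x < y \<longleftrightarrow> (\<exists>b\<in>vertex_bars k x. \<exists>c\<in>vertex_bars k y. sees S b c)"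
    if "x \<in> {1..n}" "y \<in> {1..n}" for x y
  proof
    assume "x < y"
    then show "\<exists>b\<in>vertex_bars k x. \<exists>c\<in>vertex_bars k y. sees S b c"
      using that n vertices_see[OF _ _ _ S, of x y] unfolding vertex_bars_def by fastforce
  qed (auto simp: vertex_bars_def sees_def)
  with card proper nonoverlap show ?thesis
    unfolding bar_visibility_representation_def transitive_tournament_def S_def by auto
qed

theorem theorem2p2:
  fixes n :: nat
  assumes "n \<ge> 1"
  shows "bar_visibility_number (transitive_tournament n) \<le> enat (nat \<lceil>real n / 4\<rceil>)"
proof -
  have "n \<le> 4 * nat \<lceil>real n / 4\<rceil>"
    by linarith
  from transitive_tournament_representation[OF this] show ?thesis
    unfolding bar_visibility_number_def by (intro Inf_lower) auto
qed

end
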